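(* Let $0<x_1<x_2<\cdots$ be an infinite sequence of integers (trap positions on $\mathbb{Z}_{>0}$). If $$\sum_{n=1}^{\infty}\left(x_n\prod_{r=1}^{n-1}\frac{1}{1+x_r}\right)=\infty,$$ then the model with traps $(x_k)_{k\ge1}$ is critical.
   Context: The model is the trapped random walk on the half-line: with $D_+=\{x_k\}_{k\ge1}$, it is the Markov chain on $\{0,1,2,\dots\}\cup\{s\}$ where $s$ (the sink) and $0$ are absorbing, from $x\ge 1$ with $x\notin D_+$ the walk moves to $x-1$ or $x+1$ with probability $1/2$ each, and from $x\in D_+$ it moves to $x-1$, $x+1$ or $s$ with probability $1/3$ each. Let $T$ be the first time the walk is in $\{0,s\}$, and let $\mathbb{E}_x(T)\in[0,\infty]$ be its expectation for the walk started at $x$. The model is called critical if $\mathbb{E}_1(T)=\infty$ and non-critical if $\mathbb{E}_1(T)<\infty$ (the finiteness of $\mathbb{E}_x(T)$ does not depend on the starting point $x\ge 1$). An empty product equals $1$. *)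

theory Defs
  imports "HOL-Probability.Probability"
begin

section \<open>Discrete-time Markov chains on a countable state space\<close>

text \<open>
  The law of the chain with transition kernel \<open>K\<close> started at \<open>x\<close> is the measure on
  trajectories \<open>nat \<Rightarrow> 's\<close> obtained from the Ionescu-Tulcea construction: the conditional
  law of the \<open>n\<close>-th state given the states before it is \<open>chain_step K x n\<close>.
\<close>

definition chain_step :: "('s \<Rightarrow> 's pmf) \<Rightarrow> 's \<Rightarrow> nat \<Rightarrow> (nat \<Rightarrow> 's) \<Rightarrow> 's measure" where
  "chain_step K x n \<omega> = measure_pmf (if n = 0 then return_pmf x else K (\<omega> (n - 1)))"

lemma measurable_chain_step:
  fixes K :: "'s :: countable \<Rightarrow> 's pmf"
  shows "chain_step K x n \<in>
    measurable (PiM {0..<n} (\<lambda>_. count_space UNIV)) (subprob_algebra (count_space UNIV))"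
proof (cases "n = 0")
  case True
  then show ?thesis
    by (simp add: chain_step_def[abs_def] space_subprob_algebra measure_pmf.subprob_space_axioms)
next
  case False
  then have "(\<lambda>\<omega>. \<omega> (n - 1)) \<in>
      measurable (PiM {0..<n} (\<lambda>_. count_space UNIV)) (count_space (UNIV :: 's set))"
    by (intro measurable_component_singleton) auto
  moreover have "(\<lambda>s. measure_pmf (K s)) \<in>
      measurable (count_space UNIV) (subprob_algebra (count_space UNIV))"
    by (simp add: space_subprob_algebra measure_pmf.subprob_space_axioms)
  ultimately have "(\<lambda>\<omega>. measure_pmf (K (\<omega> (n - 1)))) \<in>
      measurable (PiM {0..<n} (\<lambda>_. count_space UNIV)) (subprob_algebra (count_space UNIV))"
    by (rule measurable_compose)
  with False show ?thesis
    by (simp add: chain_step_def[abs_def])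
qed

global_interpretation chain: Ionescu_Tulcea "chain_step K x" "\<lambda>_. count_space UNIV"
  for K :: "'s :: countable \<Rightarrow> 's pmf" and x :: 's
  by unfold_locales
    (use measurable_chain_step in \<open>auto simp: chain_step_def measure_pmf.prob_space_axioms\<close>)

definition markov_chain :: "('s :: countable \<Rightarrow> 's pmf) \<Rightarrow> 's \<Rightarrow> (nat \<Rightarrow> 's) measure" where
  "markov_chain K x = chain.PF.lim K x"

lemma sets_markov_chain [simp, measurable_cong]:
  "sets (markov_chain K x) = sets (PiM UNIV (\<lambda>_. count_space UNIV))"
  by (simp add: markov_chain_def)

lemma space_markov_chain [simp]: "space (markov_chain K x) = UNIV"
  by (simp add: markov_chain_def space_PiM)

lemma emeasure_chain_C_cylinder:
  fixes K :: "'s :: countable \<Rightarrow> 's pmf"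
  shows "emeasure (chain.C K x 0 n (\<lambda>_. undefined)) (PiE {0..<n} (\<lambda>i. {p i})) =
    (\<Prod>i<n. emeasure (chain_step K x i p) {p i})"
proof (induction n)
  case 0
  show ?case
    by (simp add: PiM_empty)
next
  case (Suc n)
  let ?M = "\<lambda>_ :: nat. count_space (UNIV :: 's set)"
  let ?u = "\<lambda>_ :: nat. undefined :: 's"
  let ?A = "PiE {0..<n} (\<lambda>i. {p i})" and ?B = "PiE {0..<Suc n} (\<lambda>i. {p i})"
  have A: "?A \<in> sets (PiM {0..<n} ?M)" and B: "?B \<in> sets (PiM {0..<Suc n} ?M)"
    by (intro sets_PiM_I_finite; simp)+
  have u: "?u \<in> space (PiM {0..<0} ?M)"
    by (simp add: space_PiM)
  have ne: "space (chain.C K x 0 n ?u) \<noteq> {}"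
    using chain.prob_space_C[OF u, THEN prob_space.not_empty] .
  have eP: "chain.eP K x n \<in> measurable (chain.C K x 0 n ?u) (subprob_algebra (PiM {0..<Suc n} ?M))"
    using chain.measurable_eP[of K x n] chain.sets_C[OF u, of K x n]
    by (simp cong: measurable_cong_sets)
  have step: "emeasure (chain.eP K x n \<omega>) ?B =
      emeasure (chain_step K x n p) {p n} * indicator ?A \<omega>"
    if \<omega>: "\<omega> \<in> space (PiM {0..<n} ?M)" for \<omega>
  proof (cases "\<omega> \<in> ?A")
    case True
    then have "fun_upd \<omega> n -` ?B = {p n}"
      by (auto simp: PiE_iff extensional_def atLeastLessThanSuc)
    moreover have "chain_step K x n \<omega> = chain_step K x n p"
    proof (cases n)
      case (Suc m)
      then have "\<omega> m = p m" using True by (auto simp: PiE_iff)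
      then show ?thesis using Suc by (simp add: chain_step_def)
    qed (simp add: chain_step_def)
    ultimately show ?thesis
      using True by (simp add: chain.emeasure_eP[OF \<omega> B])
  next
    case False
    have "fun_upd \<omega> n z \<notin> ?B" for z
    proof
      assume z: "fun_upd \<omega> n z \<in> ?B"
      have "\<omega> i = p i" if "i < n" for i
        using PiE_mem[OF z, of i] that by simp
      with \<omega> have "\<omega> \<in> ?A"
        by (simp add: PiE_iff space_PiM)
      with False show False ..
    qed
    then have "fun_upd \<omega> n -` ?B = {}"
      by blast
    with False show ?thesis
      by (simp add: chain.emeasure_eP[OF \<omega> B])
  qed
  have "emeasure (chain.C K x 0 (Suc n) ?u) ?B =
      (\<integral>\<^sup>+ \<omega>. emeasure (chain.eP K x n \<omega>) ?B \<partial>chain.C K x 0 n ?u)"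
    using emeasure_bind[OF ne eP B] by simp
  also have "\<dots> = (\<integral>\<^sup>+ \<omega>. emeasure (chain_step K x n p) {p n} * indicator ?A \<omega> \<partial>chain.C K x 0 n ?u)"
    by (intro nn_integral_cong step) (use chain.space_C[OF u, of K x n] in simp)
  also have "\<dots> = emeasure (chain_step K x n p) {p n} * emeasure (chain.C K x 0 n ?u) ?A"
    using A chain.sets_C[OF u, of K x n] by (intro nn_integral_cmult_indicator) simp
  finally show ?case
    using Suc.IH by (simp add: mult.commute)
qed

lemma emeasure_markov_chain_cylinder:
  fixes K :: "'s :: countable \<Rightarrow> 's pmf"
  shows "emeasure (markov_chain K x) {\<omega>. \<forall>i\<le>n. \<omega> i = p i} =
    (if p 0 = x then ennreal (\<Prod>i<n. pmf (K (p i)) (p (Suc i))) else 0)"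
proof -
  let ?M = "\<lambda>_ :: nat. count_space (UNIV :: 's set)"
  let ?X = "PiE {0..<Suc n} (\<lambda>i. {p i})"
  have X: "?X \<in> sets (PiM {0..<Suc n} ?M)"
    by (intro sets_PiM_I_finite) auto
  have *: "{\<omega>. \<forall>i\<le>n. \<omega> i = p i} = prod_emb UNIV ?M {0..<Suc n} ?X"
    by (auto simp: prod_emb_def space_PiM PiE_iff)
  have "emeasure (markov_chain K x) {\<omega>. \<forall>i\<le>n. \<omega> i = p i} =
      emeasure (chain.CI K x {0..<Suc n}) ?X"
    unfolding * markov_chain_def by (rule chain.lim[OF _ X]) simp
  also have "\<dots> = emeasure (chain.C K x 0 (Suc n) (\<lambda>_. undefined))
      (prod_emb {0..<Suc n} ?M {0..<Suc n} ?X)"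
    by (rule chain.emeasure_CI[OF order.refl X])
  also have "prod_emb {0..<Suc n} ?M {0..<Suc n} ?X = ?X"
    by (rule prod_emb_id) (auto simp: PiE_iff)
  also have "emeasure (chain.C K x 0 (Suc n) (\<lambda>_. undefined)) ?X =
      (\<Prod>i<Suc n. emeasure (chain_step K x i p) {p i})"
    by (rule emeasure_chain_C_cylinder)
  also have "\<dots> = emeasure (return_pmf x) {p 0} * (\<Prod>i<n. ennreal (pmf (K (p i)) (p (Suc i))))"
    by (subst prod.lessThan_Suc_shift) (simp add: chain_step_def emeasure_pmf_single)
  also have "\<dots> = (if p 0 = x then ennreal (\<Prod>i<n. pmf (K (p i)) (p (Suc i))) else 0)"
    by (auto simp: emeasure_pmf_single prod_ennreal pmf_nonneg)
  finally show ?thesis .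
qed

lemma prob_space_markov_chain: "prob_space (markov_chain K x)"
proof
  have "emeasure (markov_chain K x) UNIV = emeasure (chain.CI K x {}) {\<lambda>_. undefined}"
    using chain.lim[of "{}" "{\<lambda>_. undefined}" K x]
    by (simp add: markov_chain_def prod_emb_def space_PiM PiM_empty restrict_def)
  also have "\<dots> = 1"
    using prob_space.emeasure_space_1[OF chain.PF.prob_space_P[of "{}" K x]]
    by (simp add: chain.PF.space_P space_PiM)
  finally show "emeasure (markov_chain K x) (space (markov_chain K x)) = 1"
    by simp
qed


section \<open>The trapped random walk on the half-line\<close>

datatype state = Sink | Site nat

instance state :: countable
  by countable_datatype

fun walk_kernel :: "nat set \<Rightarrow> state \<Rightarrow> state pmf" where
  "walk_kernel D Sink = return_pmf Sink"
| "walk_kernel D (Site 0) = return_pmf (Site 0)"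
| "walk_kernel D (Site (Suc m)) =
    pmf_of_set (if Suc m \<in> D then {Site m, Site (m + 2), Sink} else {Site m, Site (m + 2)})"

definition trapped_walk :: "nat set \<Rightarrow> nat \<Rightarrow> (nat \<Rightarrow> state) measure" where
  "trapped_walk D x = markov_chain (walk_kernel D) (Site x)"

text \<open>Value \<open>\<infinity>\<close> if the trajectory never reaches \<open>Site 0\<close> or \<open>Sink\<close>.\<close>

definition absorption_time :: "(nat \<Rightarrow> state) \<Rightarrow> enat" where
  "absorption_time \<omega> = (INF n \<in> {n. \<omega> n \<in> {Site 0, Sink}}. enat n)"

lemma measurable_absorption_time:
  "(\<lambda>\<omega>. ennreal_of_enat (absorption_time \<omega>)) \<in> borel_measurable (trapped_walk D x)"
proof -
  let ?H = "{Site 0, Sink}"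
  let ?f = "\<lambda>n (\<omega> :: nat \<Rightarrow> state). if \<omega> n \<in> ?H then of_nat n else (\<infinity> :: ennreal)"
  have eq: "ennreal_of_enat (absorption_time \<omega>) = (INF n. ?f n \<omega>)" for \<omega>
  proof (cases "\<exists>n. \<omega> n \<in> ?H")
    case False
    then have "absorption_time \<omega> = \<infinity>"
      by (simp add: absorption_time_def top_enat_def)
    with False show ?thesis
      by (simp add: top_unique)
  next
    case True
    define m where "m = (LEAST n. \<omega> n \<in> ?H)"
    have mH: "\<omega> m \<in> ?H"
      unfolding m_def by (rule LeastI_ex[OF True])
    have least: "m \<le> n" if "\<omega> n \<in> ?H" for n
      unfolding m_def using that by (rule Least_le)
    have "absorption_time \<omega> = enat m"
      unfolding absorption_time_def
      by (rule antisym, rule INF_lower, use mH in simp, rule INF_greatest, use least in auto)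
    moreover have "(INF n. ?f n \<omega>) = of_nat m"
    proof (rule antisym)
      show "(INF n. ?f n \<omega>) \<le> of_nat m"
        using INF_lower[of m UNIV "\<lambda>n. ?f n \<omega>"] mH by simp
      show "of_nat m \<le> (INF n. ?f n \<omega>)"
        using least by (intro INF_greatest) auto
    qed
    ultimately show ?thesis
      by simp
  qed
  have "?f n \<in> borel_measurable (PiM UNIV (\<lambda>_. count_space UNIV))" for n
    by (rule measurable_compose[OF measurable_component_singleton]) auto
  then have "(\<lambda>\<omega>. INF n. ?f n \<omega>) \<in> borel_measurable (PiM UNIV (\<lambda>_. count_space UNIV))"
    by (intro borel_measurable_INF) auto
  then show ?thesis
    unfolding eq trapped_walk_def by (simp cong: measurable_cong_sets)
qed

definition expected_absorption_time :: "nat set \<Rightarrow> nat \<Rightarrow> ennreal" where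
  "expected_absorption_time D x =
    (\<integral>\<^sup>+ \<omega>. ennreal_of_enat (absorption_time \<omega>) \<partial>trapped_walk D x)"

definition critical :: "nat set \<Rightarrow> bool" where
  "critical D \<longleftrightarrow> expected_absorption_time D 1 = \<infinity>"

end

theory Submission
  imports Defs
begin

text \<open>
  Let \<open>h y\<close> be the expected absorption time from \<open>y\<close>, supposed finite, and let \<open>\<phi>\<close> be the
  nonnegative decreasing function on \<open>{0..N + 1}\<close> that is harmonic for the killed walk on
  \<open>{1..N}\<close> and vanishes at \<open>N + 1\<close>. With \<open>m y = 3\<close> at traps and \<open>m y = 2\<close> elsewhere, the
  discrete Green identity for \<open>h\<close> and \<open>\<phi>\<close> gives \<open>\<phi> 0 * h 1 \<ge> (\<Sum>y=1..N. m y * \<phi> y)\<close>. The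
  intercepts \<open>I y = (y + 1) * \<phi> y - y * \<phi> (y + 1)\<close> of the chords of \<open>\<phi>\<close> satisfy
  \<open>(\<Sum>y=1..N. I y) = 2 * (\<Sum>y=1..N. \<phi> y)\<close>; they are constant between traps, and at a trap \<open>y\<close>
  they shrink by a factor of at least \<open>1 / (1 + y)\<close>. Hence \<open>h 1\<close> is at least the sum over
  \<open>y \<in> {1..N}\<close> of the products of \<open>1 / (1 + r)\<close> over the traps \<open>r \<le> y\<close>. Grouping \<open>y\<close> by the
  intervals between consecutive traps, these sums are unbounded in \<open>N\<close>.
\<close>

text \<open>Reciprocal of the probability of a step from a site \<open>y \<ge> 1\<close> to either
  neighbour.\<close>

definition trap_weight :: "nat set \<Rightarrow> nat \<Rightarrow> real" where
  "trap_weight D y = (if y \<in> D then 3 else 2)"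

lemma trap_weight_ge_2: "trap_weight D y \<ge> 2"
  by (simp add: trap_weight_def)

section \<open>Survival probabilities\<close>

text \<open>First-step recursion for the probability of no absorption up to time \<open>n\<close>.
  Only the lower bound \<open>emeasure_survives_ge\<close> ties it to the chain; that suffices,
  since a finite expectation has to force convergent sums.\<close>

fun survival :: "nat set \<Rightarrow> nat \<Rightarrow> nat \<Rightarrow> real" where
  "survival D n 0 = 0"
| "survival D 0 (Suc m) = 1"
| "survival D (Suc n) (Suc m) =
    (survival D n m + survival D n (m + 2)) / trap_weight D (Suc m)"

lemma survival_nonneg: "survival D n y \<ge> 0"
  by (induction D n y rule: survival.induct) (auto simp: trap_weight_def)

definition survives :: "nat \<Rightarrow> (nat \<Rightarrow> state) \<Rightarrow> bool" where
  "survives n \<omega> \<longleftrightarrow> (\<forall>i\<le>n. \<omega> i \<notin> {Site 0, Sink})"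

lemma pmf_walk_kernel:
  assumes "z \<in> {m, m + 2}"
  shows "pmf (walk_kernel D (Site (Suc m))) (Site z) = 1 / trap_weight D (Suc m)"
  using assms by (auto simp: pmf_of_set trap_weight_def indicator_def)

lemma sets_path_event:
  assumes "\<And>i. i \<le> n \<Longrightarrow> Measurable.pred (count_space UNIV) (Q i)"
  shows "{\<omega>. \<forall>i\<le>n. Q i (\<omega> i)} \<in> sets (markov_chain K x)"
proof -
  have "{\<omega>. \<forall>i\<le>n. Q i (\<omega> i)} = (\<Inter>i\<in>{..n}. (\<lambda>\<omega>. \<omega> i) -` {s. Q i s} \<inter> space (PiM UNIV (\<lambda>_. count_space UNIV)))"
    by (auto simp: space_PiM)
  also have "\<dots> \<in> sets (PiM UNIV (\<lambda>_. count_space UNIV))"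
    by (intro sets.finite_INT measurable_sets[OF measurable_component_singleton]) auto
  finally show ?thesis
    by simp
qed

lemma sets_prefix_survives:
  "{\<omega>. (\<forall>i\<le>k. \<omega> i = p i) \<and> survives n \<omega>} \<in> sets (markov_chain K x)"
proof -
  have "{\<omega>. (\<forall>i\<le>k. \<omega> i = p i) \<and> survives n \<omega>} = {\<omega>. \<forall>i\<le>k. \<omega> i = p i} \<inter> {\<omega>. survives n \<omega>}"
    by auto
  then show ?thesis
    unfolding survives_def
    using sets_path_event[of k "\<lambda>i s. s = p i" K x]
      sets_path_event[of n "\<lambda>i s. s \<notin> {Site 0, Sink}" K x] by auto
qed

text \<open>Markov property as an inequality, drawn from cylinder probabilities: lengthening the
  prefix by a step to either neighbour gives two disjoint events, so \<open>n\<close> falls while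
  \<open>k\<close> grows.\<close>

lemma prefix_survives_ge:
  assumes "survives k p" and "p k = Site y"
  shows "emeasure (markov_chain (walk_kernel D) x) {\<omega>. (\<forall>i\<le>k. \<omega> i = p i) \<and> survives (k + n) \<omega>}
    \<ge> emeasure (markov_chain (walk_kernel D) x) {\<omega>. \<forall>i\<le>k. \<omega> i = p i} * ennreal (survival D n y)"
  using assms
proof (induction n arbitrary: k p y)
  case 0
  then obtain m where y: "y = Suc m"
    by (cases y) (auto simp: survives_def)
  have "{\<omega>. (\<forall>i\<le>k. \<omega> i = p i) \<and> survives (k + 0) \<omega>} = {\<omega>. \<forall>i\<le>k. \<omega> i = p i}"
    using 0 by (auto simp: survives_def)
  then show ?case
    using y by simp
next
  case (Suc n)
  let ?M = "markov_chain (walk_kernel D) x"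
  let ?C = "\<lambda>k p. {\<omega>. \<forall>i\<le>k. \<omega> i = p i}"
  let ?E = "\<lambda>k p n. {\<omega>. (\<forall>i\<le>k. \<omega> i = p i) \<and> survives n \<omega>}"
  from Suc.prems obtain m where y: "y = Suc m"
    by (cases y) (auto simp: survives_def)
  define p' where "p' z = p(Suc k := Site z)" for z
  have step: "emeasure ?M (?E (Suc k) (p' z) (k + Suc n)) \<ge>
      emeasure ?M (?C k p) * ennreal (survival D n z / trap_weight D y)"
    if z: "z \<in> {m, m + 2}" for z
  proof (cases "z = 0")
    \<comment> \<open>The lengthened path is absorbed, so the induction hypothesis does not apply,
      but the bound is zero.\<close>
    case True
    then show ?thesis by simp
  next
    case False
    have "(\<Prod>i<k. pmf (walk_kernel D (p' z i)) (p' z (Suc i))) =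
        (\<Prod>i<k. pmf (walk_kernel D (p i)) (p (Suc i)))"
      by (intro prod.cong) (auto simp: p'_def)
    moreover have "pmf (walk_kernel D (p k)) (Site z) = 1 / trap_weight D y"
      unfolding Suc.prems(2) y by (rule pmf_walk_kernel[OF z])
    ultimately have "(\<Prod>i<Suc k. pmf (walk_kernel D (p' z i)) (p' z (Suc i))) =
        (\<Prod>i<k. pmf (walk_kernel D (p i)) (p (Suc i))) * (1 / trap_weight D y)"
      by (simp add: p'_def)
    moreover have "p' z 0 = p 0"
      by (simp add: p'_def)
    ultimately have C: "emeasure ?M (?C (Suc k) (p' z)) =
        emeasure ?M (?C k p) * ennreal (1 / trap_weight D y)"
      unfolding emeasure_markov_chain_cylinder
      using trap_weight_ge_2[of D y]
      by (simp only:) (simp add: ennreal_mult[symmetric] prod_nonneg)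
    have "survives (Suc k) (p' z)" "p' z (Suc k) = Site z"
      using Suc.prems(1) False by (auto simp: survives_def p'_def le_Suc_eq)
    from Suc.IH[OF this] have "emeasure ?M (?E (Suc k) (p' z) (k + Suc n)) \<ge>
        emeasure ?M (?C k p) * ennreal (1 / trap_weight D y) * ennreal (survival D n z)"
      unfolding C by simp
    also have "emeasure ?M (?C k p) * ennreal (1 / trap_weight D y) * ennreal (survival D n z) =
        emeasure ?M (?C k p) * ennreal (survival D n z / trap_weight D y)"
      using trap_weight_ge_2[of D y] survival_nonneg[of D n z]
      by (simp add: mult.assoc ennreal_mult[symmetric])
    finally show ?thesis .
  qed
  have nn: "survival D n z / trap_weight D y \<ge> 0" for z
    using trap_weight_ge_2[of D y] survival_nonneg[of D n z] by simp
  have "emeasure ?M (?C k p) * ennreal (survival D (Suc n) y) =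
      emeasure ?M (?C k p) * ennreal (survival D n m / trap_weight D y) +
      emeasure ?M (?C k p) * ennreal (survival D n (m + 2) / trap_weight D y)"
    using nn by (simp add: y add_divide_distrib distrib_left)
  also have "\<dots> \<le> emeasure ?M (?E (Suc k) (p' m) (k + Suc n)) +
      emeasure ?M (?E (Suc k) (p' (m + 2)) (k + Suc n))"
    by (intro add_mono step) auto
  also have "\<dots> = emeasure ?M (?E (Suc k) (p' m) (k + Suc n) \<union> ?E (Suc k) (p' (m + 2)) (k + Suc n))"
    by (rule plus_emeasure[OF sets_prefix_survives sets_prefix_survives]) (auto simp: p'_def)
  also have "\<dots> \<le> emeasure ?M (?E k p (k + Suc n))"
  proof (intro emeasure_mono sets_prefix_survives subsetI)
    fix \<omega> assume "\<omega> \<in> ?E (Suc k) (p' m) (k + Suc n) \<union> ?E (Suc k) (p' (m + 2)) (k + Suc n)"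
    then obtain z where z: "\<forall>i\<le>Suc k. \<omega> i = p' z i" "survives (k + Suc n) \<omega>"
      by blast
    have "\<omega> i = p i" if "i \<le> k" for i
      using z(1) that by (auto simp: p'_def)
    with z(2) show "\<omega> \<in> ?E k p (k + Suc n)"
      by blast
  qed
  finally show ?case .
qed

lemma emeasure_survives_ge:
  "emeasure (trapped_walk D y) {\<omega>. survives n \<omega>} \<ge> ennreal (survival D n y)"
proof (cases "y = 0")
  case False
  let ?M = "markov_chain (walk_kernel D) (Site y)"
  \<comment> \<open>Only time 0 enters the prefix, so a constant path serves.\<close>
  let ?p = "\<lambda>_ :: nat. Site y"
  have "survives 0 ?p"
    using False by (simp add: survives_def)
  from prefix_survives_ge[OF this refl, of D "Site y" n]
  have "ennreal (survival D n y) \<le> emeasure ?M {\<omega>. (\<forall>i\<le>0. \<omega> i = ?p i) \<and> survives (0 + n) \<omega>}"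
    by (simp only: emeasure_markov_chain_cylinder) simp
  also have "\<dots> \<le> emeasure ?M {\<omega>. survives n \<omega>}"
    unfolding survives_def
    by (intro emeasure_mono sets_path_event) auto
  finally show ?thesis
    by (simp add: trapped_walk_def)
qed simp

section \<open>Survival sums and the expected absorption time\<close>

lemma survives_iff_less_absorption_time: "survives n \<omega> \<longleftrightarrow> enat n < absorption_time \<omega>"
proof
  assume *: "survives n \<omega>"
  have "enat (Suc n) \<le> absorption_time \<omega>"
    unfolding absorption_time_def
  proof (rule INF_greatest)
    fix i assume "i \<in> {n. \<omega> n \<in> {Site 0, Sink}}"
    with * have "\<not> i \<le> n"
      by (auto simp: survives_def)
    then show "enat (Suc n) \<le> enat i"
      by simp
  qed
  then show "enat n < absorption_time \<omega>"
    by (simp add: Suc_ile_eq)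
next
  assume *: "enat n < absorption_time \<omega>"
  have "\<omega> i \<notin> {Site 0, Sink}" if "i \<le> n" for i
  proof
    assume "\<omega> i \<in> {Site 0, Sink}"
    then have "absorption_time \<omega> \<le> enat i"
      unfolding absorption_time_def by (intro INF_lower) simp
    with * that show False
      by (metis enat_ord_simps(1) leD order_trans)
  qed
  then show "survives n \<omega>"
    by (simp add: survives_def)
qed

text \<open>Truncated tail-sum formula: a time \<open>T\<close> is the number of \<open>n\<close>
  with \<open>n < T\<close>.\<close>

lemma sum_survives_le_absorption_time:
  "(\<Sum>n<N. indicator {\<omega>. survives n \<omega>} \<omega>) \<le> ennreal_of_enat (absorption_time \<omega>)"
proof (cases "absorption_time \<omega>")
  case (enat m)
  have "(\<Sum>n<N. indicator {\<omega>. survives n \<omega>} \<omega>) = (\<Sum>n<N. if n < m then 1 else 0 :: ennreal)"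
    by (intro sum.cong) (auto simp: survives_iff_less_absorption_time enat)
  also have "\<dots> = of_nat (card ({..<N} \<inter> {n. n < m}))"
    by (simp add: sum.If_cases)
  also have "\<dots> \<le> of_nat m"
  proof -
    have "card ({..<N} \<inter> {n. n < m}) \<le> card {..<m}"
      by (intro card_mono) auto
    then show ?thesis by simp
  qed
  finally show ?thesis
    by (simp add: enat)
qed simp

lemma expected_absorption_time_ge:
  "expected_absorption_time D y \<ge> ennreal (\<Sum>n<N. survival D n y)"
proof -
  have [measurable]: "{\<omega>. survives n \<omega>} \<in> sets (trapped_walk D y)" for n
    unfolding trapped_walk_def survives_def by (intro sets_path_event) auto
  have "ennreal (\<Sum>n<N. survival D n y) = (\<Sum>n<N. ennreal (survival D n y))"
    by (simp add: sum_ennreal survival_nonneg)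
  also have "\<dots> \<le> (\<Sum>n<N. emeasure (trapped_walk D y) {\<omega>. survives n \<omega>})"
    by (intro sum_mono emeasure_survives_ge)
  also have "\<dots> = (\<Sum>n<N. \<integral>\<^sup>+ \<omega>. indicator {\<omega>. survives n \<omega>} \<omega> \<partial>trapped_walk D y)"
    by simp
  also have "\<dots> = (\<integral>\<^sup>+ \<omega>. (\<Sum>n<N. indicator {\<omega>. survives n \<omega>} \<omega>) \<partial>trapped_walk D y)"
    by (rule nn_integral_sum[symmetric]) simp
  also have "\<dots> \<le> expected_absorption_time D y"
    unfolding expected_absorption_time_def
    by (intro nn_integral_mono sum_survives_le_absorption_time)
  finally show ?thesis .
qed

section \<open>The Poisson equation for the summed survival probabilities\<close>

text \<open>Solved for the right neighbour, the first-step recursion carries summability from sites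
  0 and 1 to all sites.\<close>

lemma survival_shift:
  assumes "y > 0"
  shows "survival D n (y + 1) = trap_weight D y * survival D (Suc n) y - survival D n (y - 1)"
proof -
  from assms obtain m where "y = Suc m"
    by (cases y) auto
  then show ?thesis
    using trap_weight_ge_2[of D "Suc m"] by (simp add: field_simps)
qed

lemma summable_survival:
  assumes "expected_absorption_time D 1 \<noteq> \<infinity>"
  shows "summable (\<lambda>n. survival D n y)"
proof -
  obtain C where C: "C \<ge> 0" "expected_absorption_time D 1 = ennreal C"
    using assms by (cases "expected_absorption_time D 1") auto
  have "(\<Sum>n<N. survival D n 1) \<le> C" for N
    using expected_absorption_time_ge[where N = N and D = D and y = 1] C by simp
  then have 1: "summable (\<lambda>n. survival D n 1)"
    by (intro summableI_nonneg_bounded[of _ C] survival_nonneg)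
  \<comment> \<open>The recursion has order two in \<open>y\<close>, so neighbouring sites go
    together.\<close>
  have "summable (\<lambda>n. survival D n y) \<and> summable (\<lambda>n. survival D n (y + 1))"
  proof (induction y)
    case (Suc y)
    then have "summable (\<lambda>n. survival D (Suc n) (y + 1))"
      using summable_Suc_iff[of "\<lambda>n. survival D n (y + 1)"] by blast
    with Suc have "summable (\<lambda>n. trap_weight D (Suc y) * survival D (Suc n) (Suc y) - survival D n y)"
      by (intro summable_diff summable_mult) auto
    moreover have "survival D n (Suc y + 1) =
        trap_weight D (Suc y) * survival D (Suc n) (Suc y) - survival D n y" for n
      using survival_shift[of "Suc y" D n] by simp
    ultimately show ?case
      using Suc by (simp only:) simp
  qed (use 1 in simp)
  then show ?thesis ..
qed

text \<open>Summation of \<open>survival_shift\<close> over \<open>n\<close>; the time shift drops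
  the term \<open>survival D 0 y = 1\<close>, whence \<open>h y - 1\<close>.\<close>

lemma poisson_suminf_survival:
  fixes D
  defines "h \<equiv> \<lambda>y. \<Sum>n. survival D n y"
  assumes "\<And>y. summable (\<lambda>n. survival D n y)" and "y > 0"
  shows "h (y + 1) = trap_weight D y * (h y - 1) - h (y - 1)"
proof -
  have "h (y + 1) = (\<Sum>n. trap_weight D y * survival D (Suc n) y - survival D n (y - 1))"
    unfolding h_def survival_shift[OF assms(3)] ..
  also have "\<dots> = trap_weight D y * (\<Sum>n. survival D (Suc n) y) - h (y - 1)"
  proof -
    have "summable (\<lambda>n. survival D (Suc n) y)"
      by (rule summable_Suc_iff[THEN iffD2, OF assms(2)])
    then show ?thesis
      unfolding h_def using assms(2)
      by (simp only: suminf_diff[symmetric] summable_mult suminf_mult)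
  qed
  also have "(\<Sum>n. survival D (Suc n) y) = h y - 1"
    using suminf_split_head[OF assms(2)[of y]] assms(3) unfolding h_def
    by (cases y) auto
  finally show ?thesis .
qed

section \<open>The killed harmonic function and its intercepts\<close>

text \<open>Indexed by the distance to the endpoint \<open>N + 1\<close>: the value at \<open>y \<le> N + 1\<close> is
  \<open>rev_harmonic D N (N + 1 - y)\<close>.\<close>

fun rev_harmonic :: "nat set \<Rightarrow> nat \<Rightarrow> nat \<Rightarrow> real" where
  "rev_harmonic D N 0 = 0"
| "rev_harmonic D N (Suc 0) = 1"
| "rev_harmonic D N (Suc (Suc k)) =
    trap_weight D (N - k) * rev_harmonic D N (Suc k) - rev_harmonic D N k"

text \<open>Weights of at least 2 make the sequence convex. The truncation of \<open>N - k\<close>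
  for \<open>k > N\<close> is harmless, as the weight bound holds at every site.\<close>

lemma rev_harmonic_mono:
  "0 \<le> rev_harmonic D N k \<and> rev_harmonic D N k \<le> rev_harmonic D N (Suc k)"
proof (induction k)
  case (Suc k)
  have "2 * rev_harmonic D N (Suc k) \<le> trap_weight D (N - k) * rev_harmonic D N (Suc k)"
    using Suc by (intro mult_right_mono trap_weight_ge_2) auto
  with Suc show ?case
    by simp
qed simp

lemma killed_harmonic_exists:
  obtains \<phi> :: "nat \<Rightarrow> real"
  where "\<phi> 0 > 0" "\<phi> (N + 1) = 0"
    "\<And>y. y \<le> N \<Longrightarrow> 0 \<le> \<phi> (y + 1) \<and> \<phi> (y + 1) \<le> \<phi> y"
    "\<And>y. 1 \<le> y \<Longrightarrow> y \<le> N \<Longrightarrow> \<phi> (y - 1) = trap_weight D y * \<phi> y - \<phi> (y + 1)"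
proof
  let ?\<phi> = "\<lambda>y. rev_harmonic D N (N + 1 - y)"
  have "rev_harmonic D N (Suc k) \<ge> 1" for k
  proof (induction k)
    case (Suc k)
    with rev_harmonic_mono[of D N "Suc k"] show ?case
      by linarith
  qed simp
  from this[of N] show "?\<phi> 0 > 0"
    by simp
  show "?\<phi> (N + 1) = 0"
    by simp
  show "0 \<le> ?\<phi> (y + 1) \<and> ?\<phi> (y + 1) \<le> ?\<phi> y" if "y \<le> N" for y
    using rev_harmonic_mono[of D N "N - y"] that by (simp add: Suc_diff_le)
  show "?\<phi> (y - 1) = trap_weight D y * ?\<phi> y - ?\<phi> (y + 1)" if "1 \<le> y" "y \<le> N" for y
  proof -
    obtain k where k: "N = y + k"
      using \<open>y \<le> N\<close> by (auto simp: le_iff_add)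
    have "N + 1 - (y - 1) = Suc (Suc k)" "N + 1 - y = Suc k" "N + 1 - (y + 1) = k" "N - k = y"
      using k that by auto
    then show ?thesis
      by simp
  qed
qed

definition trap_prod :: "nat set \<Rightarrow> nat \<Rightarrow> real" where
  "trap_prod D y = (\<Prod>r\<in>D \<inter> {1..y}. 1 / (1 + real r))"

lemma trap_prod_nonneg: "trap_prod D y \<ge> 0"
  unfolding trap_prod_def by (intro prod_nonneg) auto

lemma trap_prod_Suc:
  "trap_prod D (Suc y) = (if Suc y \<in> D then 1 / (1 + real (Suc y)) else 1) * trap_prod D y"
proof -
  have "D \<inter> {1..Suc y} = (if Suc y \<in> D then insert (Suc y) (D \<inter> {1..y}) else D \<inter> {1..y})"
    by (auto simp: le_Suc_eq)
  then show ?thesis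
    by (simp add: trap_prod_def)
qed

text \<open>Purely analytic: any nonnegative solution \<open>h\<close> of the Poisson equation with
  \<open>h 0 = 0\<close> will do.\<close>

lemma sum_trap_prod_le:
  fixes h :: "nat \<Rightarrow> real"
  assumes h0: "h 0 = 0" and h_nonneg: "\<And>y. h y \<ge> 0"
    and poisson: "\<And>y. y > 0 \<Longrightarrow> h (y + 1) = trap_weight D y * (h y - 1) - h (y - 1)"
  shows "(\<Sum>y=1..N. trap_prod D y) \<le> h 1"
proof -
  obtain \<phi> :: "nat \<Rightarrow> real" where \<phi>: "\<phi> 0 > 0" "\<phi> (N + 1) = 0"
    "\<And>y. y \<le> N \<Longrightarrow> 0 \<le> \<phi> (y + 1) \<and> \<phi> (y + 1) \<le> \<phi> y"
    "\<And>y. 1 \<le> y \<Longrightarrow> y \<le> N \<Longrightarrow> \<phi> (y - 1) = trap_weight D y * \<phi> y - \<phi> (y + 1)"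
    using killed_harmonic_exists[of N D] by metis
  define I where "I y = real (y + 1) * \<phi> y - real y * \<phi> (y + 1)" for y
  \<comment> \<open>A chord of a decreasing function meets the vertical axis no lower than at its
    left end.\<close>
  have I_ge: "I y \<ge> \<phi> y" if "y \<le> N" for y
  proof -
    have "I y - \<phi> y = real y * (\<phi> y - \<phi> (y + 1))"
      by (simp add: I_def algebra_simps)
    also have "\<dots> \<ge> 0"
      using \<phi>(3)[OF that] by simp
    finally show ?thesis by simp
  qed
  \<comment> \<open>The Wronskian of \<open>\<phi>\<close> and \<open>h\<close> telescopes. At
    \<open>n = N\<close> its remainder is \<open>\<phi> N * h (N + 1) \<ge> 0\<close>.\<close>
  have green: "\<phi> 0 * h 1 = (\<Sum>y=1..n. trap_weight D y * \<phi> y) + \<phi> n * h (n + 1) - \<phi> (n + 1) * h n"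
    if "n \<le> N" for n
    using that
  proof (induction n)
    case (Suc n)
    have p: "h (Suc (Suc n)) = trap_weight D (Suc n) * (h (Suc n) - 1) - h n"
      using poisson[of "Suc n"] by simp
    have f: "\<phi> n = trap_weight D (Suc n) * \<phi> (Suc n) - \<phi> (Suc (Suc n))"
      using \<phi>(4)[of "Suc n"] Suc.prems by simp
    have "\<phi> n * h (Suc n) - \<phi> (Suc n) * h n = trap_weight D (Suc n) * \<phi> (Suc n) +
        \<phi> (Suc n) * h (Suc (Suc n)) - \<phi> (Suc (Suc n)) * h (Suc n)"
      unfolding p f by (simp add: algebra_simps)
    with Suc show ?case
      by simp
  qed (simp add: h0)
  \<comment> \<open>Summation by parts, valid for any \<open>\<phi>\<close>; the boundary term
    vanishes at \<open>n = N\<close>.\<close>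
  have sum_I: "(\<Sum>y=1..n. I y) = 2 * (\<Sum>y=1..n. \<phi> y) - real n * \<phi> (n + 1)" for n
    by (induction n) (auto simp: I_def algebra_simps)
  have I_prod: "\<phi> 0 * trap_prod D y \<le> I y" if "y \<le> N" for y
    using that
  proof (induction y)
    case 0
    then show ?case by (simp add: trap_prod_def I_def)
  next
    case (Suc y)
    have f: "\<phi> y = trap_weight D (Suc y) * \<phi> (Suc y) - \<phi> (Suc (Suc y))"
      using \<phi>(4)[of "Suc y"] Suc.prems by simp
    \<comment> \<open>The difference is \<open>Suc y\<close> times the second difference of
      \<open>\<phi>\<close> at \<open>Suc y\<close>, which is
      \<open>(trap_weight D (Suc y) - 2) * \<phi> (Suc y)\<close>.\<close>
    have "I y - I (Suc y) = (if Suc y \<in> D then real (Suc y) * \<phi> (Suc y) else 0)"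
      unfolding I_def f by (simp add: trap_weight_def algebra_simps)
    also have "\<dots> \<le> (if Suc y \<in> D then real (Suc y) * I (Suc y) else 0)"
      using I_ge[OF Suc.prems] by (auto intro!: mult_left_mono)
    finally have "I y \<le> (if Suc y \<in> D then 1 + real (Suc y) else 1) * I (Suc y)"
      by (auto simp: algebra_simps)
    with Suc have *: "\<phi> 0 * trap_prod D y \<le> (if Suc y \<in> D then 1 + real (Suc y) else 1) * I (Suc y)"
      by simp
    show ?case
    proof (cases "Suc y \<in> D")
      case True
      have "\<phi> 0 * trap_prod D (Suc y) = \<phi> 0 * trap_prod D y / (1 + real (Suc y))"
        using True by (simp add: trap_prod_Suc)
      also have "\<dots> \<le> I (Suc y)"
        using * True by (subst pos_divide_le_eq) (auto simp: mult.commute)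
      finally show ?thesis .
    qed (use * in \<open>simp add: trap_prod_Suc\<close>)
  qed
  have "\<phi> 0 * (\<Sum>y=1..N. trap_prod D y) \<le> (\<Sum>y=1..N. I y)"
    unfolding sum_distrib_left by (intro sum_mono I_prod) auto
  also have "\<dots> = (\<Sum>y=1..N. 2 * \<phi> y)"
    using sum_I[of N] \<phi>(2) by (simp add: sum_distrib_left)
  also have "\<dots> \<le> (\<Sum>y=1..N. trap_weight D y * \<phi> y)"
  proof (intro sum_mono mult_right_mono trap_weight_ge_2)
    fix y assume "y \<in> {1..N}"
    then show "\<phi> y \<ge> 0"
      using \<phi>(3)[of y] by auto
  qed
  also have "\<dots> \<le> \<phi> 0 * h 1"
    using green[of N] \<phi>(2) \<phi>(3)[of N] h_nonneg[of "N + 1"] by simp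
  finally show ?thesis
    using \<phi>(1) by simp
qed

lemma not_critical_imp_sum_trap_prod_bounded:
  assumes "\<not> critical D"
  obtains C where "\<And>N. (\<Sum>y=1..N. trap_prod D y) \<le> C"
proof
  define h where "h y = (\<Sum>n. survival D n y)" for y
  have sm: "summable (\<lambda>n. survival D n y)" for y
    using assms by (intro summable_survival) (simp add: critical_def)
  show "(\<Sum>y=1..N. trap_prod D y) \<le> h 1" for N
  proof (rule sum_trap_prod_le)
    show "h 0 = 0"
      by (simp add: h_def)
    show "h y \<ge> 0" for y
      unfolding h_def by (intro suminf_nonneg sm survival_nonneg)
    show "h (y + 1) = trap_weight D y * (h y - 1) - h (y - 1)" if "y > 0" for y
      unfolding h_def by (rule poisson_suminf_survival[OF sm that])
  qed
qed

section \<open>Grouping by the intervals between traps\<close>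

text \<open>The traps up to \<open>y\<close> are exactly the first \<open>n\<close>. The case
  \<open>n = 0\<close> is separate because \<open>x 0\<close> is unconstrained.\<close>

lemma trap_prod_between:
  fixes x :: "nat \<Rightarrow> nat"
  assumes "0 < x 1" and mono: "strict_mono_on {1..} x"
    and "n = 0 \<or> x n \<le> y" and "y < x (Suc n)"
  shows "trap_prod (x ` {1..}) y = (\<Prod>r=1..n. 1 / (1 + real (x r)))"
proof -
  have "x ` {1..} \<inter> {1..y} = x ` {1..n}"
  proof (intro equalityI subsetI)
    fix s assume "s \<in> x ` {1..} \<inter> {1..y}"
    then obtain r where r: "r \<ge> 1" "s = x r" "x r \<le> y"
      by auto
    have "r \<le> n"
    proof (rule ccontr)
      assume "\<not> r \<le> n"
      then have "x (Suc n) \<le> x r"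
        using strict_mono_on_leD[OF mono, of "Suc n" r] by simp
      with r assms(4) show False by simp
    qed
    with r show "s \<in> x ` {1..n}" by auto
  next
    fix s assume "s \<in> x ` {1..n}"
    then obtain r where r: "1 \<le> r" "r \<le> n" "s = x r"
      by auto
    then have "x 1 \<le> x r" "x r \<le> x n"
      using strict_mono_on_leD[OF mono, of 1 r] strict_mono_on_leD[OF mono, of r n] by auto
    with r assms show "s \<in> x ` {1..} \<inter> {1..y}"
      by auto
  qed
  moreover have "inj_on x {1..n}"
    using strict_mono_on_imp_inj_on[OF mono] by (rule inj_on_subset) auto
  ultimately show ?thesis
    by (simp add: trap_prod_def prod.reindex)
qed

text \<open>The interval from \<open>x n\<close> to \<open>x (Suc n)\<close> contributes
  \<open>(x (Suc n) - x n) * P n\<close>; the subtracted part is at most \<open>P (n - 1)\<close>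
  and goes into the second sum.\<close>

lemma sum_position_prod_le:
  fixes x :: "nat \<Rightarrow> nat"
  assumes pos: "0 < x 1" and mono: "strict_mono_on {1..} x"
  defines "P \<equiv> \<lambda>n. \<Prod>r=1..n. 1 / (1 + real (x r))"
  shows "(\<Sum>n\<le>M. real (x (Suc n)) * P n) \<le>
    (\<Sum>y<x (Suc M). trap_prod (x ` {1..}) y) + (\<Sum>n<M. P n)"
proof (induction M)
  case 0
  have "(\<Sum>y<x (Suc 0). trap_prod (x ` {1..}) y) = (\<Sum>y<x (Suc 0). 1)"
    using trap_prod_between[OF pos mono, of 0] by (intro sum.cong) auto
  then show ?case
    by (simp add: P_def)
next
  case (Suc M)
  let ?W = "trap_prod (x ` {1..})"
  have le: "x (Suc M) \<le> x (Suc (Suc M))"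
    using strict_mono_on_leD[OF mono, of "Suc M" "Suc (Suc M)"] by simp
  have "{..<x (Suc (Suc M))} = {..<x (Suc M)} \<union> {x (Suc M)..<x (Suc (Suc M))}"
    using le by auto
  then have "(\<Sum>y<x (Suc (Suc M)). ?W y) =
      (\<Sum>y<x (Suc M). ?W y) + (\<Sum>y=x (Suc M)..<x (Suc (Suc M)). ?W y)"
    by (simp add: sum.union_disjoint ivl_disj_int_one(2))
  also have "(\<Sum>y=x (Suc M)..<x (Suc (Suc M)). ?W y) =
      (\<Sum>y=x (Suc M)..<x (Suc (Suc M)). P (Suc M))"
    unfolding P_def by (intro sum.cong refl trap_prod_between[OF pos mono]) auto
  also have "\<dots> = real (x (Suc (Suc M))) * P (Suc M) - real (x (Suc M)) * P (Suc M)"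
    using le by (simp add: of_nat_diff algebra_simps)
  finally have split: "(\<Sum>y<x (Suc (Suc M)). ?W y) = (\<Sum>y<x (Suc M). ?W y) +
    (real (x (Suc (Suc M))) * P (Suc M) - real (x (Suc M)) * P (Suc M))" .
  have "P M \<ge> 0"
    unfolding P_def by (intro prod_nonneg) auto
  \<comment> \<open>The last factor of \<open>P (Suc M)\<close> turns the left side into
    \<open>P M\<close> times \<open>x (Suc M) / (1 + x (Suc M))\<close>.\<close>
  then have "real (x (Suc M)) * P (Suc M) \<le> P M"
    by (simp add: P_def field_simps)
  with Suc split show ?case
    by simp
qed

theorem theorem2p11:
  fixes x :: "nat \<Rightarrow> nat"
  assumes "0 < x 1"
    and "strict_mono_on {1..} x"
    and "(\<Sum>n. ennreal (real (x (Suc n)) * (\<Prod>r=1..n. 1 / (1 + real (x r))))) = \<infinity>"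
  shows "critical (x ` {1..})"
proof (rule ccontr)
  let ?D = "x ` {1..}"
  define P where "P n = (\<Prod>r=1..n. 1 / (1 + real (x r)))" for n
  assume "\<not> critical ?D"
  then obtain C where C: "\<And>N. (\<Sum>y=1..N. trap_prod ?D y) \<le> C"
    using not_critical_imp_sum_trap_prod_bounded by metis
  \<comment> \<open>The extra 1 is the empty product at \<open>y = 0\<close>.\<close>
  have W: "(\<Sum>y<N. trap_prod ?D y) \<le> 1 + C" for N
  proof -
    have "(\<Sum>y<N. trap_prod ?D y) \<le> (\<Sum>y\<in>insert 0 {1..N}. trap_prod ?D y)"
      by (intro sum_mono2) (auto simp: trap_prod_nonneg)
    also have "\<dots> \<le> 1 + C"
      using C[of N] by (simp add: trap_prod_def)
    finally show ?thesis .
  qed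
  have P_nonneg: "P n \<ge> 0" for n
    unfolding P_def by (intro prod_nonneg) auto
  \<comment> \<open>All traps are at least 1, so each factor is at most 1/2 and the correction sum
    stays below 2.\<close>
  have P_le: "P n \<le> (1 / 2) ^ n" for n
  proof -
    have "P n \<le> (\<Prod>r=1..n. 1 / 2)"
      unfolding P_def
    proof (intro prod_mono conjI)
      fix r assume "r \<in> {1..n}"
      then have "x 1 \<le> x r"
        using strict_mono_on_leD[OF assms(2), of 1 r] by simp
      with assms(1) show "1 / (1 + real (x r)) \<le> 1 / 2"
        by (intro divide_left_mono) auto
    qed simp
    then show ?thesis by simp
  qed
  have sum_P: "(\<Sum>n<M. P n) \<le> 2" for M
  proof -
    have "(\<Sum>n<M. P n) \<le> (\<Sum>n<M. (1 / 2) ^ n)"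
      by (intro sum_mono P_le)
    also have "\<dots> \<le> 2"
      by (simp add: sum_gp_strict)
    finally show ?thesis .
  qed
  have "(\<Sum>n<M. real (x (Suc n)) * P n) \<le> 3 + C" for M
  proof -
    have "(\<Sum>n<M. real (x (Suc n)) * P n) \<le> (\<Sum>n\<le>M. real (x (Suc n)) * P n)"
      by (intro sum_mono2) (auto simp: P_nonneg)
    also have "\<dots> \<le> (\<Sum>y<x (Suc M). trap_prod ?D y) + (\<Sum>n<M. P n)"
      unfolding P_def by (rule sum_position_prod_le[OF assms(1,2)])
    also have "\<dots> \<le> 3 + C"
      using W[of "x (Suc M)"] sum_P[of M] by simp
    finally show ?thesis .
  qed
  then have "summable (\<lambda>n. real (x (Suc n)) * P n)"
    by (intro summableI_nonneg_bounded[of _ "3 + C"]) (auto simp: P_nonneg)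
  then have "(\<Sum>n. ennreal (real (x (Suc n)) * P n)) \<noteq> \<infinity>"
    by (subst suminf_ennreal2) (auto simp: P_nonneg)
  with assms(3) show False
    by (simp add: P_def)
qed

end
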